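(* Let $S\subseteq\mathcal N=\{1,\dots,n\}$ be any assortment, $T\subseteq S$ any opaque support, and $k\in\{1,\dots,n\}$. Let $r_S^*$ be the optimal uniform price of the traditional MNL model on $S$. Then uniform pricing is optimal for the price optimization problem $\max_{\bm r_S\ge \bm 0,\ \rho\ge 0}\mathrm{Rev}(\mathrm{Opq}_{(k)}(T,S,\bm r_S,\rho))$; namely, for all $\bm r_S\ge\bm 0$ and $\rho\ge 0$, $$\mathrm{Rev}\big(\mathrm{Opq}_{(k)}(T,S,\bm r_S,\rho)\big)\ \le\ \mathrm{Rev}\big(\mathrm{Opq}_{(k)}(T,S,r_S^*\bm 1_S,r_S^* )\big)\ =\ \mathrm{Rev}\big(\mathrm{Trad}(S,r_S^*\bm 1_S)\big).$$
   Context: Setting. $\mathcal N=\{1,\dots,n\}$ is a set of products with fixed intrinsic valuations $v_i\in\mathbb R$. Customer valuations are $V_i=v_i+\epsilon_i$ for $i\in\mathcal N$ and $V_0=\epsilon_0$ for the no-purchase option $0$, with $\epsilon_0,\dots,\epsilon_n$ i.i.d. standard Gumbel$(0,1)$. For $S\subseteq\mathcal N$, $\bm r_S=(r_i)_{i\in S}$ is a vector of prices; utilities are $U_i=V_i-r_i$ and $U_0=V_0$. For a scalar $r$, $r\bm 1_S$ is the price vector with all entries equal to $r$. Traditional MNL model $\mathrm{Trad}(S,\bm r_S)$: the customer picks the option of highest utility in $S\cup\{0\}$, so the expected revenue is $$\mathrm{Rev}(\mathrm{Trad}(S,\bm r_S))=\frac{\sum_{i\in S}r_ie^{v_i-r_i}}{1+\sum_{i\in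 S}e^{v_i-r_i}}.$$ The optimal uniform price $r_S^*$ is the maximizer over $r\ge 0$ of $\mathrm{Rev}(\mathrm{Trad}(S,r\bm 1_S))$ (for $S\neq\emptyset$ it is unique and is the solution of $1+\sum_{i\in S}e^{v_i-r}=r$). Opaque-MNL model $\mathrm{Opq}_{(k)}(T,S,\bm r_S,\rho)$: the products of $S$ are offered at prices $\bm r_S$ together with an opaque product $q$ at price $\rho$ with opaque support $T\subseteq S$. The customer's valuation of $q$ is $V_{(k)}^T$, the $k$-th smallest value among $\{V_j:j\in T\}$, with the convention $V_{(k)}^T=\max_{j\in T}V_j$ if $k>|T|$ (if $T=\emptyset$ this is $-\infty$, i.e. $q$ is never purchased). The utility of $q$ is $U_q=V_{(k)}^T-\rho$. The customer chooses the option of highest utility in $S\cup\{0,q\}$, ties between $q$ and another option being broken in favor of $q$. With $\pi(\cdot)$ the resulting choice probabilities, $\mathrm{Rev}(\mathrm{Opq}_{(k)}(T,S,\bm r_S,\rho))=\sum_{i\in S}r_i\,\pi(i)+\rho\,\pi(q)$. *)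

theory Defs
  imports "HOL-Probability.Probability"
begin

definition gumbel_density :: "real \<Rightarrow> real" where
  "gumbel_density x = exp (- (x + exp (- x)))"

definition iid_gumbel :: "'a measure \<Rightarrow> nat set \<Rightarrow> (nat \<Rightarrow> 'a \<Rightarrow> real) \<Rightarrow> bool" where
  "iid_gumbel M I eps \<longleftrightarrow>
     prob_space M \<and>
     prob_space.indep_vars M (\<lambda>_. borel) eps I \<and>
     (\<forall>i\<in>I. distributed M lborel (eps i) (\<lambda>x. ennreal (gumbel_density x)))"

text \<open>Option 0 is the no-purchase option: it has intrinsic valuation 0 and price 0,
  so the values of \<open>v\<close> and \<open>r\<close> at 0 are ignored.\<close>

definition valuation :: "(nat \<Rightarrow> 'a \<Rightarrow> real) \<Rightarrow> (nat \<Rightarrow> real) \<Rightarrow> 'a \<Rightarrow> nat \<Rightarrow> real" where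
  "valuation eps v \<omega> i = (if i = 0 then eps 0 \<omega> else v i + eps i \<omega>)"

definition utility ::
  "(nat \<Rightarrow> 'a \<Rightarrow> real) \<Rightarrow> (nat \<Rightarrow> real) \<Rightarrow> (nat \<Rightarrow> real) \<Rightarrow> 'a \<Rightarrow> nat \<Rightarrow> real" where
  "utility eps v r \<omega> i = valuation eps v \<omega> i - (if i = 0 then 0 else r i)"

text \<open>Under continuous independent noise, two distinct options of \<open>S \<union> {0}\<close> tie with
  probability 0, so a non-strict maximum suffices for the choice probabilities among them.\<close>

definition trad_prob ::
  "'a measure \<Rightarrow> (nat \<Rightarrow> 'a \<Rightarrow> real) \<Rightarrow> (nat \<Rightarrow> real) \<Rightarrow> nat set \<Rightarrow> (nat \<Rightarrow> real) \<Rightarrow> nat \<Rightarrow> real" where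
  "trad_prob M eps v S r i =
     measure M {\<omega> \<in> space M. \<forall>j \<in> insert 0 S. utility eps v r \<omega> j \<le> utility eps v r \<omega> i}"

definition trad_revenue ::
  "'a measure \<Rightarrow> (nat \<Rightarrow> 'a \<Rightarrow> real) \<Rightarrow> (nat \<Rightarrow> real) \<Rightarrow> nat set \<Rightarrow> (nat \<Rightarrow> real) \<Rightarrow> real" where
  "trad_revenue M eps v S r = (\<Sum>i\<in>S. r i * trad_prob M eps v S r i)"

text \<open>For \<open>S = {}\<close> the revenue is constantly 0 and this is an arbitrary nonnegative price.\<close>

definition opt_uniform_price ::
  "'a measure \<Rightarrow> (nat \<Rightarrow> 'a \<Rightarrow> real) \<Rightarrow> (nat \<Rightarrow> real) \<Rightarrow> nat set \<Rightarrow> real" where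
  "opt_uniform_price M eps v S =
     arg_max (\<lambda>r. trad_revenue M eps v S (\<lambda>_. r)) (\<lambda>r. 0 \<le> r)"

text \<open>The order statistic counts multiplicities, and list positions start at 0.\<close>

definition opaque_valuation :: "nat \<Rightarrow> nat set \<Rightarrow> (nat \<Rightarrow> real) \<Rightarrow> ereal" where
  "opaque_valuation k T V =
     (if T = {} then - \<infinity>
      else if k \<le> card T then ereal (sort (map V (sorted_list_of_set T)) ! (k - 1))
      else ereal (Max (V ` T)))"

definition opaque_utility ::
  "(nat \<Rightarrow> 'a \<Rightarrow> real) \<Rightarrow> (nat \<Rightarrow> real) \<Rightarrow> nat \<Rightarrow> nat set \<Rightarrow> real \<Rightarrow> 'a \<Rightarrow> ereal" where
  "opaque_utility eps v k T \<rho> \<omega> = opaque_valuation k T (valuation eps v \<omega>) - ereal \<rho>"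

text \<open>Ties with the opaque product can have positive probability (if its valuation coincides
  with that of a product of equal price) and are broken in its favor.\<close>

definition opq_prob_product ::
  "'a measure \<Rightarrow> (nat \<Rightarrow> 'a \<Rightarrow> real) \<Rightarrow> (nat \<Rightarrow> real) \<Rightarrow> nat \<Rightarrow> nat set \<Rightarrow> nat set \<Rightarrow>
     (nat \<Rightarrow> real) \<Rightarrow> real \<Rightarrow> nat \<Rightarrow> real" where
  "opq_prob_product M eps v k T S r \<rho> i =
     measure M {\<omega> \<in> space M.
       (\<forall>j \<in> insert 0 S. utility eps v r \<omega> j \<le> utility eps v r \<omega> i) \<and>
       opaque_utility eps v k T \<rho> \<omega> < ereal (utility eps v r \<omega> i)}"

definition opq_prob_opaque ::
  "'a measure \<Rightarrow> (nat \<Rightarrow> 'a \<Rightarrow> real) \<Rightarrow> (nat \<Rightarrow> real) \<Rightarrow> nat \<Rightarrow> nat set \<Rightarrow> nat set \<Rightarrow>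
     (nat \<Rightarrow> real) \<Rightarrow> real \<Rightarrow> real" where
  "opq_prob_opaque M eps v k T S r \<rho> =
     measure M {\<omega> \<in> space M.
       \<forall>j \<in> insert 0 S. ereal (utility eps v r \<omega> j) \<le> opaque_utility eps v k T \<rho> \<omega>}"

definition opq_revenue ::
  "'a measure \<Rightarrow> (nat \<Rightarrow> 'a \<Rightarrow> real) \<Rightarrow> (nat \<Rightarrow> real) \<Rightarrow> nat \<Rightarrow> nat set \<Rightarrow> nat set \<Rightarrow>
     (nat \<Rightarrow> real) \<Rightarrow> real \<Rightarrow> real" where
  "opq_revenue M eps v k T S r \<rho> =
     (\<Sum>i\<in>S. r i * opq_prob_product M eps v k T S r \<rho> i)
       + \<rho> * opq_prob_opaque M eps v k T S r \<rho>"

end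

theory Submission
  imports Defs
begin

text \<open>
  Let \<open>R\<close> solve \<open>(\<Sum>i\<in>S. exp (v i)) * exp (- R - 1) = R\<close>; then the uniform price \<open>R + 1\<close> earns \<open>R\<close>,
  and it remains to show that the expected payment never exceeds \<open>R\<close>. Equivalently, the expected surplus
  (payment minus \<open>R\<close>) over all sales is at most \<open>R\<close> times the probability of no purchase. Charge a sale of
  the opaque product to the product \<open>j\<close> whose valuation it inherits. For Gumbel noise, the event that
  \<open>V j - p\<close> beats \<open>V 0\<close> and satisfies a condition on its value and on the other valuations is
  \<open>exp (v j - p)\<close> times as likely as the event that \<open>V 0\<close> beats \<open>V j - p\<close> and satisfies the same
  condition. Applied to the sale of \<open>j\<close> at its own price and to the opaque sale charged to \<open>j\<close>, this yields
  disjoint events on which nothing is purchased; since \<open>(p - R) * exp (- p) \<le> exp (- R - 1)\<close>, the surplus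
  charged to \<open>j\<close> is at most \<open>exp (v j - R - 1)\<close> times the probability of no purchase. Summing over \<open>j\<close>
  gives the claim.
\<close>

section \<open>Gumbel noise\<close>

definition gumbel :: "real measure" where
  "gumbel = density lborel (\<lambda>x. ennreal (gumbel_density x))"

lemma borel_measurable_gumbel_density [measurable]: "gumbel_density \<in> borel_measurable borel"
  unfolding gumbel_density_def[abs_def] by measurable

lemma sets_gumbel [simp, measurable_cong]: "sets gumbel = sets borel"
  by (simp add: gumbel_def)

lemma space_gumbel [simp]: "space gumbel = UNIV"
  by (simp add: gumbel_def)

lemma sigma_finite_gumbel: "sigma_finite_measure gumbel"
  unfolding gumbel_def by (subst sigma_finite_measure.sigma_finite_iff_density_finite) (auto intro: sigma_finite_lborel)

lemma nn_integral_gumbel: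
  "f \<in> borel_measurable borel \<Longrightarrow>
     (\<integral>\<^sup>+x. f x \<partial>gumbel) = (\<integral>\<^sup>+x. ennreal (gumbel_density x) * f x \<partial>lborel)"
  unfolding gumbel_def by (subst nn_integral_density) auto

lemma emeasure_gumbel_atMost: "emeasure gumbel {..t} = ennreal (exp (- exp (- t)))"
proof -
  let ?f = "\<lambda>y::real. exp (y - exp y)" and ?F = "\<lambda>y::real. - exp (- exp y)"
  have "emeasure gumbel {..t} = (\<integral>\<^sup>+x. ennreal (gumbel_density x) * indicator {..t} x \<partial>lborel)"
    unfolding gumbel_def by (subst emeasure_density) auto
  \<comment> \<open>The reflection x = -y turns the lower tail into a half line reaching to
    infinity, the shape required by \<open>nn_integral_FTC_atLeast\<close>.\<close>
  also have "\<dots> = (\<integral>\<^sup>+y. ennreal (gumbel_density (- y)) * indicator {..t} (- y) \<partial>lborel)"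
    by (subst nn_integral_real_affine[of _ "-1" 0]) auto
  also have "\<dots> = (\<integral>\<^sup>+y. ennreal (?f y) * indicator {- t..} y \<partial>lborel)"
    by (intro nn_integral_cong) (auto simp: gumbel_density_def indicator_def)
  also have "\<dots> = ennreal (0 - ?F (- t))"
  proof (rule nn_integral_FTC_atLeast)
    show "(?F \<longlongrightarrow> 0) at_top"
      by real_asymp
    show "DERIV ?F y :> ?f y" for y
      by (auto intro!: derivative_eq_intros simp: exp_diff exp_minus field_simps)
  qed auto
  finally show ?thesis by simp
qed

lemma emeasure_gumbel_singleton: "emeasure gumbel {x} = 0"
proof -
  have "emeasure gumbel {x} = (\<integral>\<^sup>+y. ennreal (gumbel_density y) * indicator {x} y \<partial>lborel)"
    unfolding gumbel_def by (subst emeasure_density) auto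
  also have "\<dots> = 0"
    by (subst nn_integral_indicator_singleton) auto
  finally show ?thesis .
qed

lemma emeasure_gumbel_lessThan: "emeasure gumbel {..<t} = ennreal (exp (- exp (- t)))"
proof -
  have "emeasure gumbel {..t} = emeasure gumbel {..<t} + emeasure gumbel {t}"
    by (subst plus_emeasure) (auto simp: ivl_disj_un intro: arg_cong2[where f = emeasure])
  then show ?thesis
    by (simp add: emeasure_gumbel_singleton emeasure_gumbel_atMost)
qed

text \<open>Both sides integrate over the value t in \<open>W\<close> taken by the winner. With F t
  = \<open>exp (- exp (- t))\<close>, the integrand is \<open>gumbel_density (t - c)\<close> * F t
  on the left and \<open>gumbel_density t\<close> * F (t - c) on the right. Both are multiples of
  \<open>exp (- t)\<close> * F t * F (t - c), with factors \<open>exp c\<close> and 1.\<close>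

lemma gumbel_race:
  assumes [measurable]: "W \<in> sets borel"
  shows "emeasure (gumbel \<Otimes>\<^sub>M gumbel) {(x, y). x \<le> y + c \<and> y + c \<in> W} =
    ennreal (exp c) * emeasure (gumbel \<Otimes>\<^sub>M gumbel) {(x, y). y + c < x \<and> x \<in> W}"
proof -
  interpret G: sigma_finite_measure gumbel by (rule sigma_finite_gumbel)
  interpret GG: pair_sigma_finite gumbel gumbel ..
  let ?F = "\<lambda>t::real. exp (- exp (- t))"
  have "{p \<in> space (gumbel \<Otimes>\<^sub>M gumbel). fst p \<le> snd p + c \<and> snd p + c \<in> W} \<in> sets (gumbel \<Otimes>\<^sub>M gumbel)"
    "{p \<in> space (gumbel \<Otimes>\<^sub>M gumbel). snd p + c < fst p \<and> fst p \<in> W} \<in> sets (gumbel \<Otimes>\<^sub>M gumbel)"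
    by measurable
  then have [measurable]: "{(x, y). x \<le> y + c \<and> y + c \<in> W} \<in> sets (gumbel \<Otimes>\<^sub>M gumbel)"
    "{(x, y). y + c < x \<and> x \<in> W} \<in> sets (gumbel \<Otimes>\<^sub>M gumbel)"
    by (simp_all add: space_pair_measure case_prod_unfold)
  have "emeasure (gumbel \<Otimes>\<^sub>M gumbel) {(x, y). x \<le> y + c \<and> y + c \<in> W} =
      (\<integral>\<^sup>+y. emeasure gumbel ((\<lambda>x. (x, y)) -` {(x, y). x \<le> y + c \<and> y + c \<in> W}) \<partial>gumbel)"
    by (rule GG.emeasure_pair_measure_alt2) measurable
  also have "\<dots> = (\<integral>\<^sup>+y. ennreal (?F (y + c)) * indicator W (y + c) \<partial>gumbel)"
    by (intro nn_integral_cong)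
       (auto simp: indicator_def vimage_def emeasure_gumbel_atMost[unfolded atMost_def])
  also have "\<dots> = (\<integral>\<^sup>+y. ennreal (gumbel_density y) * (ennreal (?F (y + c)) * indicator W (y + c)) \<partial>lborel)"
    by (rule nn_integral_gumbel) measurable
  also have "\<dots> = (\<integral>\<^sup>+x. ennreal (gumbel_density (x - c)) * (ennreal (?F x) * indicator W x) \<partial>lborel)"
    by (subst nn_integral_real_affine[of _ 1 c]) (auto simp: add.commute)
  also have "\<dots> = (\<integral>\<^sup>+x. ennreal (exp c) * (ennreal (gumbel_density x) * (ennreal (?F (x - c)) * indicator W x)) \<partial>lborel)"
    by (intro nn_integral_cong)
       (auto simp: indicator_def gumbel_density_def mult_exp_exp algebra_simps simp flip: ennreal_mult)
  also have "\<dots> = ennreal (exp c) * (\<integral>\<^sup>+x. ennreal (gumbel_density x) * (ennreal (?F (x - c)) * indicator W x) \<partial>lborel)"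
    by (rule nn_integral_cmult) measurable
  also have "(\<integral>\<^sup>+x. ennreal (gumbel_density x) * (ennreal (?F (x - c)) * indicator W x) \<partial>lborel)
      = (\<integral>\<^sup>+x. ennreal (?F (x - c)) * indicator W x \<partial>gumbel)"
    by (rule nn_integral_gumbel[symmetric]) measurable
  also have "\<dots> = (\<integral>\<^sup>+x. emeasure gumbel (Pair x -` {(x, y). y + c < x \<and> x \<in> W}) \<partial>gumbel)"
    by (intro nn_integral_cong)
       (auto simp: indicator_def vimage_def emeasure_gumbel_lessThan[unfolded lessThan_def]
         simp flip: less_diff_eq)
  also have "\<dots> = emeasure (gumbel \<Otimes>\<^sub>M gumbel) {(x, y). y + c < x \<and> x \<in> W}"
    by (rule G.emeasure_pair_measure_alt[symmetric]) measurable
  finally show ?thesis .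
qed

lemma gumbel_tie_sets: "{p. fst p = snd p + c} \<in> sets (gumbel \<Otimes>\<^sub>M gumbel)"
proof -
  have "{p \<in> space (gumbel \<Otimes>\<^sub>M gumbel). fst p = snd p + c} \<in> sets (gumbel \<Otimes>\<^sub>M gumbel)"
    by measurable
  moreover have "space (gumbel \<Otimes>\<^sub>M gumbel) = UNIV"
    by (simp add: space_pair_measure)
  ultimately show ?thesis
    by (simp only: UNIV_I simp_thms)
qed

lemma gumbel_no_tie: "emeasure (gumbel \<Otimes>\<^sub>M gumbel) {p. fst p = snd p + c} = 0"
proof -
  interpret G: sigma_finite_measure gumbel by (rule sigma_finite_gumbel)
  interpret GG: pair_sigma_finite gumbel gumbel ..
  show ?thesis
    by (subst GG.emeasure_pair_measure_alt2[OF gumbel_tie_sets])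
       (simp add: vimage_def emeasure_gumbel_singleton)
qed

section \<open>Order statistics\<close>

text \<open>The entries that are at least \<open>x\<close> form a final segment of the sorted list,
  so their number decides whether the segment reaches back to position \<open>p\<close>.\<close>

lemma le_nth_sort_iff:
  fixes x :: "'a :: linorder"
  assumes "p < length xs"
  shows "x \<le> sort xs ! p \<longleftrightarrow> length xs - p \<le> length (filter (\<lambda>y. x \<le> y) xs)"
proof -
  let ?ys = "sort xs"
  have "length (filter (\<lambda>y. x \<le> y) xs) = length (filter (\<lambda>y. x \<le> y) ?ys)"
    by (simp add: filter_sort)
  also have "\<dots> = card {i. i < length ?ys \<and> x \<le> ?ys ! i}"
    by (rule length_filter_conv_card)
  finally have len: "length (filter (\<lambda>y. x \<le> y) xs) = card {i. i < length ?ys \<and> x \<le> ?ys ! i}" .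
  have mono: "?ys ! a \<le> ?ys ! b" if "a \<le> b" "b < length xs" for a b
    using that by (intro sorted_nth_mono) auto
  show ?thesis
  proof
    assume "x \<le> ?ys ! p"
    then have "{p..<length xs} \<subseteq> {i. i < length ?ys \<and> x \<le> ?ys ! i}"
      using mono[of p] by (auto intro: order_trans)
    then have "card {p..<length xs} \<le> card {i. i < length ?ys \<and> x \<le> ?ys ! i}"
      by (intro card_mono) auto
    then show "length xs - p \<le> length (filter (\<lambda>y. x \<le> y) xs)"
      by (simp add: len)
  next
    assume le: "length xs - p \<le> length (filter (\<lambda>y. x \<le> y) xs)"
    show "x \<le> ?ys ! p"
    proof (rule ccontr)
      assume "\<not> x \<le> ?ys ! p"
      then have "p < i" if "x \<le> ?ys ! i" for i
        using mono[OF _ assms, of i] that by (meson le_less_linear order_trans)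
      then have "{i. i < length ?ys \<and> x \<le> ?ys ! i} \<subseteq> {Suc p..<length xs}"
        by (auto simp: Suc_le_eq)
      then have "card {i. i < length ?ys \<and> x \<le> ?ys ! i} \<le> card {Suc p..<length xs}"
        by (intro card_mono) auto
      with le assms show False by (simp add: len)
    qed
  qed
qed

text \<open>One count covers all cases of the convention. For \<open>k \<le> card T\<close> the list
  index k - 1 leaves \<open>card T - k\<close> + 1 entries from there on. For
  \<open>k > card T\<close> the difference truncates to 0 and a single large valuation suffices, as
  for a maximum. For empty \<open>T\<close> the count is never positive.\<close>

lemma le_opaque_valuation_iff:
  assumes "finite T" "1 \<le> k"
  shows "ereal x \<le> opaque_valuation k T V \<longleftrightarrow> card T - k < card {i \<in> T. x \<le> V i}"
proof -
  consider "T = {}" | "T \<noteq> {}" "k \<le> card T" | "T \<noteq> {}" "card T < k"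
    by linarith
  then show ?thesis
  proof cases
    case 1
    then show ?thesis by (simp add: opaque_valuation_def)
  next
    case 2
    let ?xs = "map V (sorted_list_of_set T)"
    have "length (filter (\<lambda>y. x \<le> y) ?xs) = length (filter (\<lambda>i. x \<le> V i) (sorted_list_of_set T))"
      by (simp add: filter_map comp_def)
    also have "\<dots> = card {i \<in> T. x \<le> V i}"
      using assms(1) by (simp add: distinct_length_filter Int_def conj_commute)
    finally have "length (filter (\<lambda>y. x \<le> y) ?xs) = card {i \<in> T. x \<le> V i}" .
    with 2 assms show ?thesis
      by (auto simp: opaque_valuation_def le_nth_sort_iff)
  next
    case 3
    have "x \<le> Max (V ` T) \<longleftrightarrow> (\<exists>i\<in>T. x \<le> V i)"
      using 3 assms by (subst Max_ge_iff) auto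
    also have "\<dots> \<longleftrightarrow> 0 < card {i \<in> T. x \<le> V i}"
      using assms by (auto simp: card_gt_0_iff)
    finally show ?thesis
      using 3 by (simp add: opaque_valuation_def)
  qed
qed

lemma opaque_valuation_attained:
  assumes "finite T" "T \<noteq> {}" "1 \<le> k"
  obtains i where "i \<in> T" "opaque_valuation k T V = ereal (V i)"
proof (cases "k \<le> card T")
  case True
  let ?xs = "map V (sorted_list_of_set T)"
  have "sort ?xs ! (k - 1) \<in> set (sort ?xs)"
    using True assms by (intro nth_mem) auto
  then show thesis
    using that True assms by (auto simp: opaque_valuation_def)
next
  case False
  have "Max (V ` T) \<in> V ` T"
    using assms by simp
  then obtain i where "i \<in> T" "Max (V ` T) = V i"
    by blast
  then show thesis
    using that[of i] False assms by (simp add: opaque_valuation_def)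
qed

text \<open>The threshold criterion at \<open>V i\<close> bounds the number of elements above from
  below; its failure at every larger valuation bounds it from above, where distinctness makes the
  other valuations above strictly larger.\<close>

lemma opaque_valuation_rank:
  assumes T: "finite T" "inj_on V T" and k: "1 \<le> k" and i: "i \<in> T"
  shows "opaque_valuation k T V = ereal (V i) \<longleftrightarrow> card {l \<in> T - {i}. V i \<le> V l} = card T - k"
proof -
  let ?above = "{l \<in> T - {i}. V i \<le> V l}"
  have "{l \<in> T. V i \<le> V l} = insert i ?above"
    using i by auto
  then have card: "card {l \<in> T. V i \<le> V l} = Suc (card ?above)"
    using T by simp
  show ?thesis
  proof
    assume eq: "opaque_valuation k T V = ereal (V i)"
    then have "card T - k \<le> card ?above"
      using le_opaque_valuation_iff[OF T(1) k, of "V i" V] card by simp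
    moreover have "card ?above \<le> card T - k"
    proof (rule ccontr)
      assume less: "\<not> card ?above \<le> card T - k"
      \<comment> \<open>\<open>m\<close> is the next valuation above \<open>V i\<close>. With more
        than \<open>card T - k\<close> others reaching it, the opaque valuation would be at least
        \<open>m\<close>.\<close>
      define m where "m = Min (V ` ?above)"
      have ne: "?above \<noteq> {}"
        using less by (metis card.empty le0)
      then have "m \<in> V ` ?above"
        unfolding m_def using T by (intro Min_in) auto
      moreover have "V i < V l" if "l \<in> ?above" for l
        using that T(2) i by (auto simp: inj_on_def order_le_less)
      ultimately have "V i < m"
        by blast
      have "card ?above \<le> card {l \<in> T. m \<le> V l}"
        using T by (intro card_mono) (auto simp: m_def)
      with less have "ereal m \<le> opaque_valuation k T V"
        by (simp add: le_opaque_valuation_iff[OF T(1) k])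
      with \<open>V i < m\<close> eq show False by simp
    qed
    ultimately show "card ?above = card T - k" by simp
  next
    assume rank: "card ?above = card T - k"
    obtain l where l: "l \<in> T" "opaque_valuation k T V = ereal (V l)"
      using opaque_valuation_attained[OF T(1) _ k] i by blast
    have "V i \<le> V l"
      using le_opaque_valuation_iff[OF T(1) k, of "V i" V] rank card l by simp
    moreover have "\<not> V i < V l"
    proof
      assume "V i < V l"
      then have "{h \<in> T. V l \<le> V h} \<subseteq> ?above" by auto
      then have "card {h \<in> T. V l \<le> V h} \<le> card ?above"
        using T by (intro card_mono) auto
      with rank show False
        using le_opaque_valuation_iff[OF T(1) k, of "V l" V] l by simp
    qed
    ultimately show "opaque_valuation k T V = ereal (V i)"
      using l by simp
  qed
qed

section \<open>Exchanging the roles of a product and the no-purchase option\<close>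

locale gumbel_choice = prob_space M for M :: "'a measure" +
  fixes n :: nat and eps :: "nat \<Rightarrow> 'a \<Rightarrow> real" and v :: "nat \<Rightarrow> real"
  assumes indep: "indep_vars (\<lambda>_. borel) eps {0..n}"
    and distr_eps: "\<And>i. i \<le> n \<Longrightarrow> distr M borel (eps i) = gumbel"
begin

abbreviation V :: "'a \<Rightarrow> nat \<Rightarrow> real" where
  "V \<equiv> valuation eps v"

lemma measurable_eps [measurable]: "i \<le> n \<Longrightarrow> eps i \<in> borel_measurable M"
  using indep by (auto simp: indep_vars_def)

lemma measurable_V [measurable]: "i \<le> n \<Longrightarrow> (\<lambda>\<omega>. V \<omega> i) \<in> borel_measurable M"
  unfolding valuation_def by measurable

lemma distr_eps_pair:
  assumes "i \<le> n" "j \<le> n" "i \<noteq> j"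
  shows "distr M (borel \<Otimes>\<^sub>M borel) (\<lambda>\<omega>. (eps i \<omega>, eps j \<omega>)) = gumbel \<Otimes>\<^sub>M gumbel"
proof -
  have "indep_var (PiM {i} (\<lambda>_. borel)) (\<lambda>\<omega>. restrict (\<lambda>i. eps i \<omega>) {i})
      (PiM {j} (\<lambda>_. borel)) (\<lambda>\<omega>. restrict (\<lambda>i. eps i \<omega>) {j})"
    using assms by (intro indep_var_restrict[OF indep]) auto
  then have "indep_var borel ((\<lambda>x. x i) \<circ> (\<lambda>\<omega>. restrict (\<lambda>i. eps i \<omega>) {i}))
      borel ((\<lambda>x. x j) \<circ> (\<lambda>\<omega>. restrict (\<lambda>i. eps i \<omega>) {j}))"
    by (rule indep_var_compose) (auto intro: measurable_component_singleton)
  then have "indep_var borel (eps i) borel (eps j)"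
    by (simp add: comp_def)
  then show ?thesis
    using assms by (simp add: indep_var_distribution_eq distr_eps)
qed

lemma AE_no_tie:
  assumes "i \<le> n" "j \<le> n" "i \<noteq> j"
  shows "AE \<omega> in M. V \<omega> i - p \<noteq> V \<omega> j - q"
proof -
  \<comment> \<open>The constant absorbs intrinsic valuations and prices, so a tie in utility
    becomes the noise tie \<open>eps i \<omega> = eps j \<omega> + c\<close>.\<close>
  define c where "c = (if j = 0 then 0 else v j) - (if i = 0 then 0 else v i) + p - q"
  have "AE x in distr M (borel \<Otimes>\<^sub>M borel) (\<lambda>\<omega>. (eps i \<omega>, eps j \<omega>)). fst x \<noteq> snd x + c"
  proof (rule AE_I')
    show "{x. fst x = snd x + c} \<in> null_sets (distr M (borel \<Otimes>\<^sub>M borel) (\<lambda>\<omega>. (eps i \<omega>, eps j \<omega>)))"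
      unfolding distr_eps_pair[OF assms] null_sets_def
      using gumbel_no_tie[of c] gumbel_tie_sets[of c] by blast
  qed auto
  then have "AE \<omega> in M. eps i \<omega> \<noteq> eps j \<omega> + c"
    using assms by (subst (asm) AE_distr_iff) auto
  then show ?thesis
    by eventually_elim (auto simp: valuation_def c_def split: if_splits)
qed

lemma AE_distinct_utilities:
  assumes "J \<subseteq> {0..n}"
  shows "AE \<omega> in M. inj_on (\<lambda>i. V \<omega> i - r i) J"
proof -
  have fin: "finite J"
    using assms finite_subset by blast
  have "AE \<omega> in M. \<forall>i\<in>J. \<forall>j\<in>J. i \<noteq> j \<longrightarrow> V \<omega> i - r i \<noteq> V \<omega> j - r j"
    using assms AE_no_tie fin by (intro AE_finite_allI) (auto simp: subset_iff)
  then show ?thesis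
    by eventually_elim (auto simp: inj_on_def)
qed

text \<open>The blocks \<open>{0, j}\<close> and \<open>K\<close> are disjoint, hence independent;
  reading the first block as a pair then gives two independent Gumbel variables.\<close>

lemma distr_eps_joint:
  assumes "j \<in> {1..n}"
  defines "K \<equiv> {1..n} - {j}"
  defines "Z \<equiv> \<lambda>\<omega>. restrict (\<lambda>i. eps i \<omega>) K"
  shows "distr M ((borel \<Otimes>\<^sub>M borel) \<Otimes>\<^sub>M PiM K (\<lambda>_. borel)) (\<lambda>\<omega>. ((eps 0 \<omega>, eps j \<omega>), Z \<omega>)) =
    (gumbel \<Otimes>\<^sub>M gumbel) \<Otimes>\<^sub>M distr M (PiM K (\<lambda>_. borel)) Z"
proof -
  let ?Y = "\<lambda>\<omega>. restrict (\<lambda>i. eps i \<omega>) {0, j}"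
  let ?N = "PiM {0, j} (\<lambda>_. borel :: real measure)" and ?P = "PiM K (\<lambda>_. borel :: real measure)"
  let ?f = "\<lambda>x :: nat \<Rightarrow> real. (x 0, x j)"
  have ind: "indep_var ?N ?Y ?P Z"
    unfolding Z_def using assms by (intro indep_var_restrict[OF indep]) auto
  then have Y: "?Y \<in> measurable M ?N" and Z: "Z \<in> measurable M ?P"
    and joint: "distr M ?N ?Y \<Otimes>\<^sub>M distr M ?P Z = distr M (?N \<Otimes>\<^sub>M ?P) (\<lambda>\<omega>. (?Y \<omega>, Z \<omega>))"
    by (auto simp: indep_var_distribution_eq)
  have f: "?f \<in> measurable ?N (borel \<Otimes>\<^sub>M borel)"
    by (auto intro!: measurable_Pair measurable_component_singleton)
  interpret DZ: prob_space "distr M ?P Z"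
    by (rule prob_space_distr) (rule Z)
  have "gumbel \<Otimes>\<^sub>M gumbel = distr (distr M ?N ?Y) (borel \<Otimes>\<^sub>M borel) ?f"
    using assms by (subst distr_distr[OF f Y]) (simp add: comp_def distr_eps_pair)
  \<comment> \<open>The second factor is written as its own image under the identity so that
    \<open>pair_measure_distr\<close> applies.\<close>
  then have "(gumbel \<Otimes>\<^sub>M gumbel) \<Otimes>\<^sub>M distr M ?P Z =
      distr (distr M ?N ?Y) (borel \<Otimes>\<^sub>M borel) ?f \<Otimes>\<^sub>M distr (distr M ?P Z) ?P (\<lambda>z. z)"
    by (simp add: distr_distr[OF _ Z] comp_def)
  also have "\<dots> = distr (distr M ?N ?Y \<Otimes>\<^sub>M distr M ?P Z) ((borel \<Otimes>\<^sub>M borel) \<Otimes>\<^sub>M ?P) (\<lambda>(x, z). (?f x, z))"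
    using f DZ.sigma_finite_measure_axioms
    by (intro pair_measure_distr) (auto simp: distr_distr[OF _ Z] comp_def)
  also have "\<dots> = distr M ((borel \<Otimes>\<^sub>M borel) \<Otimes>\<^sub>M ?P) (\<lambda>\<omega>. (?f (?Y \<omega>), Z \<omega>))"
    unfolding joint
    by (subst distr_distr)
       (auto simp: comp_def intro!: measurable_Pair measurable_compose[OF measurable_fst f] Y Z
         simp: case_prod_unfold)
  finally show ?thesis by simp
qed

text \<open>Fixing the other noise variables, which are independent of the pair for 0 and
  \<open>j\<close>, leaves a race of two to which \<open>gumbel_race\<close> applies with the slice
  of \<open>W\<close>. Since the factor \<open>exp c\<close> is the same for every slice, Fubini
  gives the claim.\<close>

lemma exchange_noise:
  assumes "j \<in> {1..n}"
  defines "K \<equiv> {1..n} - {j}"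
  defines "Z \<equiv> \<lambda>\<omega>. restrict (\<lambda>i. eps i \<omega>) K"
  assumes W [measurable]: "Measurable.pred (borel \<Otimes>\<^sub>M PiM K (\<lambda>_. borel)) (\<lambda>p. W (fst p) (snd p))"
  shows "\<P>(\<omega> in M. eps 0 \<omega> \<le> eps j \<omega> + c \<and> W (eps j \<omega> + c) (Z \<omega>)) =
    exp c * \<P>(\<omega> in M. eps j \<omega> + c < eps 0 \<omega> \<and> W (eps 0 \<omega>) (Z \<omega>))"
proof -
  let ?P = "PiM K (\<lambda>_. borel :: real measure)"
  let ?D = "distr M ?P Z"
  let ?X = "\<lambda>\<omega>. ((eps 0 \<omega>, eps j \<omega>), Z \<omega>)"
  let ?N = "(borel \<Otimes>\<^sub>M borel :: (real \<times> real) measure) \<Otimes>\<^sub>M ?P"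
  define A where "A = {q \<in> space ?N. fst (fst q) \<le> snd (fst q) + c \<and> W (snd (fst q) + c) (snd q)}"
  define B where "B = {q \<in> space ?N. snd (fst q) + c < fst (fst q) \<and> W (fst (fst q)) (snd q)}"
  have [measurable]: "eps 0 \<in> borel_measurable M" "eps j \<in> borel_measurable M"
    using assms by auto
  have Z [measurable]: "Z \<in> measurable M ?P"
    unfolding Z_def K_def by (intro measurable_restrict measurable_eps) auto
  interpret D: prob_space ?D
    by (rule prob_space_distr) (rule Z)
  interpret G: sigma_finite_measure gumbel by (rule sigma_finite_gumbel)
  interpret GG: pair_sigma_finite gumbel gumbel ..
  interpret GGD: pair_sigma_finite "gumbel \<Otimes>\<^sub>M gumbel" ?D ..
  have W': "Measurable.pred ?N (\<lambda>q. W (f q) (snd q))" if "f \<in> borel_measurable ?N" for f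
    using measurable_compose[OF measurable_Pair[OF that measurable_snd] W] by simp
  have [measurable]: "A \<in> sets ?N" "B \<in> sets ?N"
  proof -
    have [measurable]: "Measurable.pred ?N (\<lambda>q. W (snd (fst q) + c) (snd q))"
      "Measurable.pred ?N (\<lambda>q. W (fst (fst q)) (snd q))"
      by (auto intro: W'[of "\<lambda>q. snd (fst q) + c"] W'[of "\<lambda>q. fst (fst q)"])
    show "A \<in> sets ?N" "B \<in> sets ?N"
      unfolding A_def B_def by measurable
  qed
  have sets_eq: "sets ((gumbel \<Otimes>\<^sub>M gumbel) \<Otimes>\<^sub>M ?D) = sets ?N"
    by (intro sets_pair_measure_cong) auto
  have joint: "distr M ?N ?X = (gumbel \<Otimes>\<^sub>M gumbel) \<Otimes>\<^sub>M ?D"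
    unfolding Z_def K_def by (rule distr_eps_joint[OF assms(1)])
  have prob_eq: "emeasure M (?X -` C \<inter> space M) = emeasure ((gumbel \<Otimes>\<^sub>M gumbel) \<Otimes>\<^sub>M ?D) C"
    if "C \<in> sets ?N" for C
  proof -
    have "?X \<in> measurable M ?N"
      by measurable
    from emeasure_distr[OF this that] show ?thesis
      by (simp only: joint)
  qed
  have slice: "emeasure (gumbel \<Otimes>\<^sub>M gumbel) ((\<lambda>p. (p, z)) -` A) =
      ennreal (exp c) * emeasure (gumbel \<Otimes>\<^sub>M gumbel) ((\<lambda>p. (p, z)) -` B)" if z: "z \<in> space ?P" for z
  proof -
    have "{x \<in> space borel. W x z} \<in> sets borel"
      using measurable_compose[OF measurable_Pair2'[OF z, of borel] W] by (simp add: pred_def)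
    then have "{x. W x z} \<in> sets borel" by simp
    from gumbel_race[OF this, of c] z show ?thesis
      by (simp add: A_def B_def vimage_def space_pair_measure case_prod_unfold)
  qed
  have "emeasure M (?X -` A \<inter> space M) =
      (\<integral>\<^sup>+z. emeasure (gumbel \<Otimes>\<^sub>M gumbel) ((\<lambda>p. (p, z)) -` A) \<partial>?D)"
    by (simp add: prob_eq GGD.emeasure_pair_measure_alt2 sets_eq)
  also have "\<dots> = (\<integral>\<^sup>+z. ennreal (exp c) * emeasure (gumbel \<Otimes>\<^sub>M gumbel) ((\<lambda>p. (p, z)) -` B) \<partial>?D)"
    by (rule nn_integral_cong) (simp add: slice)
  also have "\<dots> = ennreal (exp c) * (\<integral>\<^sup>+z. emeasure (gumbel \<Otimes>\<^sub>M gumbel) ((\<lambda>p. (p, z)) -` B) \<partial>?D)"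
    by (intro nn_integral_cmult GGD.measurable_emeasure_Pair2) (simp add: sets_eq)
  also have "\<dots> = ennreal (exp c) * emeasure M (?X -` B \<inter> space M)"
    by (simp add: prob_eq GGD.emeasure_pair_measure_alt2 sets_eq)
  finally have "emeasure M (?X -` A \<inter> space M) = ennreal (exp c) * emeasure M (?X -` B \<inter> space M)" .
  moreover have "?X -` A \<inter> space M =
      {\<omega> \<in> space M. eps 0 \<omega> \<le> eps j \<omega> + c \<and> W (eps j \<omega> + c) (Z \<omega>)}"
    using measurable_space[OF Z] by (auto simp: A_def space_pair_measure)
  moreover have "?X -` B \<inter> space M =
      {\<omega> \<in> space M. eps j \<omega> + c < eps 0 \<omega> \<and> W (eps 0 \<omega>) (Z \<omega>)}"
    using measurable_space[OF Z] by (auto simp: B_def space_pair_measure)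
  ultimately have "emeasure M {\<omega> \<in> space M. eps 0 \<omega> \<le> eps j \<omega> + c \<and> W (eps j \<omega> + c) (Z \<omega>)} =
      ennreal (exp c) * emeasure M {\<omega> \<in> space M. eps j \<omega> + c < eps 0 \<omega> \<and> W (eps 0 \<omega>) (Z \<omega>)}"
    by simp
  then show ?thesis
    by (simp add: emeasure_eq_measure flip: ennreal_mult)
qed

lemma exchange:
  assumes "j \<in> {1..n}"
  defines "K \<equiv> {1..n} - {j}"
  assumes W [measurable]: "Measurable.pred (borel \<Otimes>\<^sub>M PiM K (\<lambda>_. borel)) (\<lambda>p. W (fst p) (snd p))"
  shows "\<P>(\<omega> in M. V \<omega> 0 \<le> V \<omega> j - p \<and> W (V \<omega> j - p) (restrict (V \<omega>) K)) =
    exp (v j - p) * \<P>(\<omega> in M. V \<omega> j - p < V \<omega> 0 \<and> W (V \<omega> 0) (restrict (V \<omega>) K))"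
proof -
  \<comment> \<open>The intrinsic valuations of the other products are moved into the condition,
    which reduces the claim to noise variables.\<close>
  define W' where "W' x z = W x (\<lambda>i\<in>K. v i + z i)" for x z
  have "(\<lambda>p. (fst p, \<lambda>i\<in>K. v i + snd p i)) \<in>
      measurable (borel \<Otimes>\<^sub>M PiM K (\<lambda>_. borel)) (borel \<Otimes>\<^sub>M PiM K (\<lambda>_. borel))"
    by measurable
  from measurable_compose[OF this W]
  have "Measurable.pred (borel \<Otimes>\<^sub>M PiM K (\<lambda>_. borel)) (\<lambda>p. W' (fst p) (snd p))"
    by (simp add: W'_def)
  note eq = exchange_noise[OF assms(1) this[unfolded K_def], folded K_def, of "v j - p"]
  have "restrict (V \<omega>) K = (\<lambda>i\<in>K. v i + (\<lambda>i\<in>K. eps i \<omega>) i)" for \<omega>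
    by (auto simp: valuation_def K_def restrict_def)
  moreover have "V \<omega> j - p = eps j \<omega> + (v j - p)" "V \<omega> 0 = eps 0 \<omega>" for \<omega>
    using assms(1) by (auto simp: valuation_def)
  ultimately show ?thesis
    using eq by (simp only: W'_def)
qed

text \<open>For \<open>p > R\<close>, \<open>exchange\<close> introduces the factor
  \<open>exp (v j - p)\<close>, and \<open>p - R \<le> exp (p - R - 1)\<close>, with equality at p =
  R + 1, removes \<open>p\<close> from the coefficient. For \<open>p \<le> R\<close> the left side
  is nonpositive.\<close>

lemma surplus_bound:
  assumes j: "j \<in> {1..n}"
  defines "K \<equiv> {1..n} - {j}"
  assumes W: "Measurable.pred (borel \<Otimes>\<^sub>M PiM K (\<lambda>_. borel)) (\<lambda>p. W (fst p) (snd p))"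
    and E: "\<And>\<omega>. \<omega> \<in> space M \<Longrightarrow> E \<omega> \<Longrightarrow> V \<omega> 0 \<le> V \<omega> j - p \<and> W (V \<omega> j - p) (restrict (V \<omega>) K)"
  shows "(p - R) * \<P>(\<omega> in M. E \<omega>) \<le>
    exp (v j - R - 1) * \<P>(\<omega> in M. V \<omega> j - p < V \<omega> 0 \<and> W (V \<omega> 0) (restrict (V \<omega>) K))"
    (is "_ \<le> _ * ?Q")
proof (cases "p \<le> R")
  case True
  then have "(p - R) * \<P>(\<omega> in M. E \<omega>) \<le> 0"
    by (simp add: mult_nonpos_nonneg)
  also have "0 \<le> exp (v j - R - 1) * ?Q"
    by simp
  finally show ?thesis .
next
  case False
  have [measurable]: "Measurable.pred M (\<lambda>\<omega>. W (V \<omega> j - p) (restrict (V \<omega>) K))"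
  proof -
    have "(\<lambda>\<omega>. (V \<omega> j - p, restrict (V \<omega>) K)) \<in> measurable M (borel \<Otimes>\<^sub>M PiM K (\<lambda>_. borel))"
      using j by (intro measurable_Pair measurable_restrict borel_measurable_diff measurable_V) (auto simp: K_def)
    from measurable_compose[OF this W] show ?thesis by simp
  qed
  have [measurable]: "(\<lambda>\<omega>. V \<omega> j) \<in> borel_measurable M" "(\<lambda>\<omega>. V \<omega> 0) \<in> borel_measurable M"
    using j by auto
  have "\<P>(\<omega> in M. E \<omega>) \<le> \<P>(\<omega> in M. V \<omega> 0 \<le> V \<omega> j - p \<and> W (V \<omega> j - p) (restrict (V \<omega>) K))"
    using E by (intro finite_measure_mono) (auto, measurable)
  also have "\<dots> = exp (v j - p) * ?Q"
    unfolding K_def by (rule exchange[OF j W[unfolded K_def]])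
  finally have "(p - R) * \<P>(\<omega> in M. E \<omega>) \<le> (p - R) * (exp (v j - p) * ?Q)"
    using False by (intro mult_left_mono) auto
  also have "\<dots> = (p - R) * exp (v j - p) * ?Q"
    by simp
  also have "\<dots> \<le> exp (v j - R - 1) * ?Q"
  proof (rule mult_right_mono)
    have "p - R \<le> exp (p - R - 1)"
      using exp_ge_add_one_self[of "p - R - 1"] by simp
    then have "(p - R) * exp (v j - p) \<le> exp (p - R - 1) * exp (v j - p)"
      by (rule mult_right_mono) simp
    also have "\<dots> = exp (v j - R - 1)"
      by (simp add: mult_exp_exp)
    finally show "(p - R) * exp (v j - p) \<le> exp (v j - R - 1)" .
  qed simp
  finally show ?thesis .
qed

end

section \<open>The market with an opaque product\<close>

lemma measurable_pred_le:
  fixes f g :: "'a \<Rightarrow> real"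
  assumes [measurable]: "f \<in> borel_measurable N" "g \<in> borel_measurable N"
  shows "Measurable.pred N (\<lambda>x. f x \<le> g x)"
  by measurable

lemma measurable_card_Collect:
  fixes A :: "nat set"
  assumes "\<And>i. i \<in> A \<Longrightarrow> Measurable.pred N (P i)"
  shows "(\<lambda>x. card {i \<in> A. P i x}) \<in> measurable N (count_space UNIV)"
proof (rule measurable_card)
  show "{x \<in> space N. i \<in> {i \<in> A. P i x}} \<in> sets N" for i
    using assms[of i] by (cases "i \<in> A") (auto simp: pred_def)
qed

lemma card_Collect_remove:
  assumes "finite A" "a \<in> A"
  shows "card {i \<in> A. P i} = card {i \<in> A - {a}. P i} + (if P a then 1 else 0)"
proof -
  have "{i \<in> A. P i} = (if P a then insert a {i \<in> A - {a}. P i} else {i \<in> A - {a}. P i})"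
    using assms by auto
  with assms show ?thesis by simp
qed

lemma opaque_utility_less_iff:
  assumes "finite T" "1 \<le> k"
  shows "opaque_utility eps v k T \<rho> \<omega> < ereal u \<longleftrightarrow>
    card {i \<in> T. u + \<rho> \<le> valuation eps v \<omega> i} \<le> card T - k"
proof -
  have "a - ereal \<rho> < ereal u \<longleftrightarrow> \<not> ereal (u + \<rho>) \<le> a" for a
    by (cases a) auto
  then show ?thesis
    by (simp add: opaque_utility_def le_opaque_valuation_iff[OF assms] not_less)
qed

locale opaque_market = gumbel_choice +
  fixes k :: nat and S T :: "nat set" and r :: "nat \<Rightarrow> real" and \<rho> :: real
  assumes S: "S \<subseteq> {1..n}" and T: "T \<subseteq> S" and k: "1 \<le> k"
begin

abbreviation U :: "'a \<Rightarrow> nat \<Rightarrow> real" where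
  "U \<equiv> utility eps v r"

text \<open>The order statistic is at least \<open>x\<close> iff more than \<open>card T - k\<close> valuations are; the truncation of the
  subtraction accounts for the convention for \<open>k > card T\<close>.\<close>

abbreviation beats_opaque :: "real \<Rightarrow> 'a \<Rightarrow> bool" where
  "beats_opaque u \<omega> \<equiv> card {i \<in> T. u + \<rho> \<le> V \<omega> i} \<le> card T - k"

text \<open>Option \<open>0\<close> counts as a product here: \<open>buys 0\<close> is the event of no purchase.\<close>

definition buys :: "nat \<Rightarrow> 'a \<Rightarrow> bool" where
  "buys j \<omega> \<longleftrightarrow> (\<forall>i\<in>insert 0 S. U \<omega> i \<le> U \<omega> j) \<and> beats_opaque (U \<omega> j) \<omega>"

definition buys_opaque :: "'a \<Rightarrow> bool" where
  "buys_opaque \<omega> \<longleftrightarrow> (\<forall>i\<in>insert 0 S. \<not> beats_opaque (U \<omega> i) \<omega>)"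

text \<open>The opaque product is bought and product \<open>j\<close> is the one attaining its valuation. The rank condition
  expresses this only up to ties among the valuations, that is, almost surely.\<close>

definition buys_opaque_as :: "nat \<Rightarrow> 'a \<Rightarrow> bool" where
  "buys_opaque_as j \<omega> \<longleftrightarrow> j \<in> T \<and> card {i \<in> T - {j}. V \<omega> j \<le> V \<omega> i} = card T - k \<and>
     (\<forall>i\<in>insert 0 S. U \<omega> i \<le> V \<omega> j - \<rho>)"

lemma finite_S: "finite S"
  using S by (rule finite_subset) simp

lemma finite_T: "finite T"
  using T finite_S by (rule finite_subset)

lemma S_le: "i \<in> insert 0 S \<Longrightarrow> i \<le> n" "i \<in> S \<Longrightarrow> i \<noteq> 0"
  using S by auto

lemma U_0: "U \<omega> 0 = V \<omega> 0" and U_S: "i \<in> S \<Longrightarrow> U \<omega> i = V \<omega> i - r i"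
  using S_le(2) by (auto simp: utility_def)

section \<open>Choice probabilities as counting events, and their measurability\<close>

lemma opq_prob_product_eq:
  "opq_prob_product M eps v k T S r \<rho> i = \<P>(\<omega> in M. buys i \<omega>)"
  by (simp add: opq_prob_product_def buys_def opaque_utility_less_iff[OF finite_T k])

lemma opq_prob_opaque_eq:
  "opq_prob_opaque M eps v k T S r \<rho> = \<P>(\<omega> in M. buys_opaque \<omega>)"
proof -
  have "ereal u \<le> opaque_utility eps v k T \<rho> \<omega> \<longleftrightarrow> \<not> beats_opaque u \<omega>" for u \<omega>
    unfolding opaque_utility_less_iff[OF finite_T k, symmetric] by (rule not_less[symmetric])
  then show ?thesis
    by (simp only: opq_prob_opaque_def buys_opaque_def)
qed

lemma measurable_U: "i \<in> insert 0 S \<Longrightarrow> (\<lambda>\<omega>. U \<omega> i) \<in> borel_measurable M"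
  using S_le measurable_V[of i] unfolding utility_def by auto

lemma measurable_V': "i \<in> insert 0 S \<union> T \<Longrightarrow> (\<lambda>\<omega>. V \<omega> i) \<in> borel_measurable M"
  using S T by (intro measurable_V) auto

lemma measurable_beats_opaque:
  assumes "f \<in> borel_measurable M"
  shows "Measurable.pred M (\<lambda>\<omega>. beats_opaque (f \<omega>) \<omega>)"
proof -
  have [measurable]: "(\<lambda>\<omega>. card {i \<in> T. f \<omega> + \<rho> \<le> V \<omega> i}) \<in> measurable M (count_space UNIV)"
    using assms by (intro measurable_card_Collect measurable_pred_le) (auto intro: measurable_V')
  show ?thesis by measurable
qed

lemma measurable_buys:
  assumes "j \<in> insert 0 S"
  shows "Measurable.pred M (buys j)"
proof -
  have [measurable]: "Measurable.pred M (\<lambda>\<omega>. \<forall>i\<in>insert 0 S. U \<omega> i \<le> U \<omega> j)"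
    using assms finite_S
    by (intro pred_intros_countable_bounded measurable_pred_le measurable_U) (auto intro: countable_finite)
  have [measurable]: "Measurable.pred M (\<lambda>\<omega>. beats_opaque (U \<omega> j) \<omega>)"
    using assms by (intro measurable_beats_opaque measurable_U)
  show ?thesis
    unfolding buys_def[abs_def] by measurable
qed

lemma measurable_buys_opaque: "Measurable.pred M buys_opaque"
proof -
  have "Measurable.pred M (\<lambda>\<omega>. \<not> beats_opaque (U \<omega> i) \<omega>)" if "i \<in> insert 0 S" for i
    by (intro pred_intros_logic(2) measurable_beats_opaque measurable_U that)
  then show ?thesis
    unfolding buys_opaque_def[abs_def] using finite_S
    by (intro pred_intros_countable_bounded) (auto intro: countable_finite)
qed

lemma measurable_buys_opaque_as:
  assumes "j \<in> S"
  shows "Measurable.pred M (buys_opaque_as j)"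
proof -
  have [measurable]: "(\<lambda>\<omega>. card {i \<in> T - {j}. V \<omega> j \<le> V \<omega> i}) \<in> measurable M (count_space UNIV)"
    using assms by (intro measurable_card_Collect measurable_pred_le measurable_V') auto
  have [measurable]: "Measurable.pred M (\<lambda>\<omega>. \<forall>i\<in>insert 0 S. U \<omega> i \<le> V \<omega> j - \<rho>)"
    using assms finite_S
    by (intro pred_intros_countable_bounded measurable_pred_le measurable_U
        borel_measurable_diff measurable_V') (auto intro: countable_finite)
  show ?thesis
    unfolding buys_opaque_as_def[abs_def] by measurable
qed

lemma events:
  "j \<in> insert 0 S \<Longrightarrow> {\<omega> \<in> space M. buys j \<omega>} \<in> events"
  "{\<omega> \<in> space M. buys_opaque \<omega>} \<in> events"
  "j \<in> S \<Longrightarrow> {\<omega> \<in> space M. buys_opaque_as j \<omega>} \<in> events"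
  using measurable_buys measurable_buys_opaque measurable_buys_opaque_as by (auto simp: pred_def)

section \<open>Almost sure decomposition of the sample space into purchase events\<close>

lemma AE_inj_U: "AE \<omega> in M. inj_on (U \<omega>) (insert 0 S)"
proof -
  have "AE \<omega> in M. inj_on (\<lambda>i. V \<omega> i - (if i = 0 then 0 else r i)) (insert 0 S)"
    using S by (intro AE_distinct_utilities) auto
  moreover have "(\<lambda>i. V \<omega> i - (if i = 0 then 0 else r i)) = U \<omega>" for \<omega>
    by (simp add: utility_def fun_eq_iff)
  ultimately show ?thesis
    by (simp only:)
qed

lemma AE_inj_V: "AE \<omega> in M. inj_on (V \<omega>) T"
proof -
  have "T \<subseteq> {0..n}"
    using S T by auto
  from AE_distinct_utilities[OF this, of "\<lambda>_. 0"] show ?thesis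
    by simp
qed

lemma beats_opaque_mono:
  assumes "beats_opaque u \<omega>" "u \<le> u'"
  shows "beats_opaque u' \<omega>"
proof -
  have "card {i \<in> T. u' + \<rho> \<le> V \<omega> i} \<le> card {i \<in> T. u + \<rho> \<le> V \<omega> i}"
    using finite_T assms(2) by (intro card_mono) auto
  with assms(1) show ?thesis
    by (rule order_trans[rotated])
qed

text \<open>Almost surely a unique option of \<open>insert 0 S\<close> has the highest utility. If
  any option beats the opaque product, so does this one by \<open>beats_opaque_mono\<close>; hence
  exactly one of the events occurs.\<close>

lemma sum_prob_buys:
  "(\<Sum>j\<in>insert 0 S. \<P>(\<omega> in M. buys j \<omega>)) + \<P>(\<omega> in M. buys_opaque \<omega>) = 1"
proof -
  have "\<P>(\<omega> in M. \<not> buys_opaque \<omega>) = (\<Sum>j\<in>insert 0 S. \<P>(\<omega> in M. buys j \<omega>))"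
  proof (rule prob_sum)
    show "{\<omega> \<in> space M. \<not> buys_opaque \<omega>} \<in> events"
      using events(2) by simp
    show "AE \<omega> in M. (\<forall>j\<in>insert 0 S. buys j \<omega> \<longrightarrow> \<not> buys_opaque \<omega>) \<and>
        (\<not> buys_opaque \<omega> \<longrightarrow> (\<exists>!j\<in>insert 0 S. buys j \<omega>))"
      using AE_inj_U
    proof eventually_elim
      case (elim \<omega>)
      have "Max (U \<omega> ` insert 0 S) \<in> U \<omega> ` insert 0 S"
        using finite_S by (intro Max_in) auto
      then obtain j where j: "j \<in> insert 0 S" and max: "Max (U \<omega> ` insert 0 S) = U \<omega> j"
        by blast
      have best: "U \<omega> i \<le> U \<omega> j" if "i \<in> insert 0 S" for i
        unfolding max[symmetric] using finite_S that by (intro Max_ge) auto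
      have "buys j \<omega>" if "\<not> buys_opaque \<omega>"
      proof -
        from that have "\<exists>i\<in>insert 0 S. beats_opaque (U \<omega> i) \<omega>"
          unfolding buys_opaque_def
          by (rule contrapos_np) (intro ballI notI, erule notE, erule bexI)
        then obtain i where i: "i \<in> insert 0 S" "beats_opaque (U \<omega> i) \<omega>" ..
        have "beats_opaque (U \<omega> j) \<omega>"
          by (rule beats_opaque_mono[OF i(2) best[OF i(1)]])
        with best show ?thesis
          unfolding buys_def by simp
      qed
      moreover have "i = j" if "i \<in> insert 0 S" "buys i \<omega>" for i
      proof -
        have "U \<omega> j \<le> U \<omega> i"
          using that(2) bspec[OF _ j] unfolding buys_def by fast
        with best[OF that(1)] have "U \<omega> i = U \<omega> j"
          by (rule order_antisym)
        then show ?thesis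
          by (rule inj_onD[OF elim _ that(1) j])
      qed
      moreover have "\<not> buys_opaque \<omega>" if "i \<in> insert 0 S" "buys i \<omega>" for i
        using that(2) bspec[OF _ that(1)] unfolding buys_def buys_opaque_def by fast
      ultimately show ?case
        using j by blast
    qed
  qed (use finite_S events(1) in auto)
  then show ?thesis
    using prob_neg[OF events(2)] by simp
qed

text \<open>Almost surely the valuations in \<open>T\<close> are distinct, so exactly one product
  attains the opaque valuation, and \<open>opaque_valuation_rank\<close> identifies it by its
  rank.\<close>

lemma prob_buys_opaque:
  "\<P>(\<omega> in M. buys_opaque \<omega>) = (\<Sum>j\<in>S. \<P>(\<omega> in M. buys_opaque_as j \<omega>))"
proof (rule prob_sum)
  show "AE \<omega> in M. (\<forall>j\<in>S. buys_opaque_as j \<omega> \<longrightarrow> buys_opaque \<omega>) \<and>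
      (buys_opaque \<omega> \<longrightarrow> (\<exists>!j\<in>S. buys_opaque_as j \<omega>))"
    using AE_inj_V
  proof eventually_elim
    case (elim \<omega>)
    note rank = opaque_valuation_rank[OF finite_T elim k]
    have opaque_iff: "buys_opaque \<omega> \<longleftrightarrow> (\<forall>i\<in>insert 0 S. ereal (U \<omega> i + \<rho>) \<le> opaque_valuation k T (V \<omega>))"
      unfolding buys_opaque_def by (simp add: le_opaque_valuation_iff[OF finite_T k] not_le)
    have as_iff: "buys_opaque_as j \<omega> \<longleftrightarrow>
        j \<in> T \<and> opaque_valuation k T (V \<omega>) = ereal (V \<omega> j) \<and> buys_opaque \<omega>" for j
      unfolding buys_opaque_as_def opaque_iff using rank[of j] by (auto simp: le_diff_eq)
    have "\<exists>!j. j \<in> S \<and> buys_opaque_as j \<omega>" if "buys_opaque \<omega>"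
    proof -
      have "T \<noteq> {}"
        using that by (auto simp: buys_opaque_def)
      then obtain j where "j \<in> T" "opaque_valuation k T (V \<omega>) = ereal (V \<omega> j)"
        using opaque_valuation_attained[OF finite_T _ k] by blast
      then show ?thesis
        using that T elim unfolding as_iff by (intro ex1I[of _ j]) (auto dest: inj_onD)
    qed
    then show ?case
      unfolding as_iff by blast
  qed
qed (use finite_S events in auto)

section \<open>Charging sales to products\<close>

text \<open>This is the condition handed to \<open>exchange\<close>: it refers to a value
  \<open>x\<close> and to products other than \<open>j\<close> only. The same condition therefore
  makes sense at \<open>x = V \<omega> j - p\<close>, when \<open>j\<close> is sold, and at
  \<open>x = V \<omega> 0\<close>, when nothing is. The set \<open>A\<close> prescribes how many
  others in \<open>T\<close> reach the opaque threshold.\<close>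

definition rivals :: "nat \<Rightarrow> nat set \<Rightarrow> real \<Rightarrow> (nat \<Rightarrow> real) \<Rightarrow> bool" where
  "rivals j A x z \<longleftrightarrow>
     (\<forall>i\<in>S - {j}. z i - r i \<le> x) \<and> card {i \<in> T - {j}. x + \<rho> \<le> z i} \<in> A"

lemma rivals_restrict: "rivals j A x (restrict z ({1..n} - {j})) = rivals j A x z"
proof -
  have "{i \<in> T - {j}. x + \<rho> \<le> restrict z ({1..n} - {j}) i} = {i \<in> T - {j}. x + \<rho> \<le> z i}"
    using S T by auto
  moreover have "(\<forall>i\<in>S - {j}. restrict z ({1..n} - {j}) i - r i \<le> x) \<longleftrightarrow> (\<forall>i\<in>S - {j}. z i - r i \<le> x)"
    using S by (intro ball_cong) auto
  ultimately show ?thesis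
    by (simp add: rivals_def)
qed

lemma measurable_rivals:
  assumes "\<And>i. i \<in> S - {j} \<Longrightarrow> (\<lambda>x. g x i) \<in> borel_measurable N"
    and [measurable]: "f \<in> borel_measurable N"
  shows "Measurable.pred N (\<lambda>x. rivals j A (f x) (g x))"
proof -
  have [measurable]: "(\<lambda>x. card {i \<in> T - {j}. f x + \<rho> \<le> g x i}) \<in> measurable N (count_space UNIV)"
    using assms T by (intro measurable_card_Collect measurable_pred_le) auto
  have [measurable]: "Measurable.pred N (\<lambda>x. \<forall>i\<in>S - {j}. g x i - r i \<le> f x)"
    using assms finite_S
    by (intro pred_intros_countable_bounded measurable_pred_le) (auto intro: countable_finite)
  show ?thesis
    unfolding rivals_def by measurable
qed

lemma rivals_bound:
  assumes j: "j \<in> S"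
    and E: "\<And>\<omega>. \<omega> \<in> space M \<Longrightarrow> E \<omega> \<Longrightarrow> V \<omega> 0 \<le> V \<omega> j - p \<and> rivals j A (V \<omega> j - p) (V \<omega>)"
  shows "(p - R) * \<P>(\<omega> in M. E \<omega>) \<le>
    exp (v j - R - 1) * \<P>(\<omega> in M. V \<omega> j - p < V \<omega> 0 \<and> rivals j A (V \<omega> 0) (V \<omega>))"
proof -
  have "Measurable.pred (borel \<Otimes>\<^sub>M PiM ({1..n} - {j}) (\<lambda>_. borel)) (\<lambda>x. rivals j A (fst x) (snd x))"
    using S by (intro measurable_rivals measurable_compose[OF measurable_snd] measurable_component_singleton) auto
  moreover have "j \<in> {1..n}"
    using j S by blast
  ultimately show ?thesis
    using surplus_bound[of j "rivals j A" E p R, unfolded rivals_restrict] E by blast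
qed

text \<open>The case split is on whether own-price and opaque sales charged to \<open>j\<close> may
  carry different prices. If so, they are exchanged separately, and different rival counts keep the
  images disjoint; otherwise they are merged and exchanged once at price \<open>r j\<close>.\<close>

lemma product_bound:
  assumes j: "j \<in> S"
  shows "(r j - R) * \<P>(\<omega> in M. buys j \<omega>) + (\<rho> - R) * \<P>(\<omega> in M. buys_opaque_as j \<omega>)
    \<le> exp (v j - R - 1) * \<P>(\<omega> in M. buys 0 \<omega>)"
proof (cases "j \<in> T \<and> \<rho> < r j")
  \<comment> \<open>Here \<open>j\<close> sells at its own price only if fewer than \<open>card T - k\<close> other valuations in \<open>T\<close> reach the
    opaque threshold, whereas an opaque sale charged to \<open>j\<close> needs exactly \<open>card T - k\<close>.\<close>
  case True
  then have jT: "j \<in> T" and less: "\<rho> < r j" by auto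
  have split: "card {i \<in> T. P i} = card {i \<in> T - {j}. P i} + (if P j then 1 else 0)" for P
    by (rule card_Collect_remove[OF finite_T jT])
  let ?A = "{\<omega> \<in> space M. V \<omega> j - r j < V \<omega> 0 \<and> rivals j {..<card T - k} (V \<omega> 0) (V \<omega>)}"
  let ?B = "{\<omega> \<in> space M. V \<omega> j - \<rho> < V \<omega> 0 \<and> rivals j {card T - k} (V \<omega> 0) (V \<omega>)}"
  have ev: "{\<omega> \<in> space M. V \<omega> j - p < V \<omega> 0 \<and> rivals j A (V \<omega> 0) (V \<omega>)} \<in> events" for p A
  proof -
    have [measurable]: "(\<lambda>\<omega>. V \<omega> j) \<in> borel_measurable M" "(\<lambda>\<omega>. V \<omega> 0) \<in> borel_measurable M"
      "Measurable.pred M (\<lambda>\<omega>. rivals j A (V \<omega> 0) (V \<omega>))"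
      using j by (auto intro!: measurable_rivals measurable_V')
    show ?thesis by measurable
  qed
  have "(r j - R) * \<P>(\<omega> in M. buys j \<omega>) \<le> exp (v j - R - 1) * prob ?A"
  proof (rule rivals_bound[OF j])
    fix \<omega> assume buys: "buys j \<omega>"
    \<comment> \<open>As \<open>\<rho> < r j\<close>, product \<open>j\<close> itself reaches the
      threshold and uses up one of the \<open>card T - k\<close> admissible places.\<close>
    have "card {i \<in> T - {j}. V \<omega> j - r j + \<rho> \<le> V \<omega> i} < card T - k"
      using buys less j split[of "\<lambda>i. V \<omega> j - r j + \<rho> \<le> V \<omega> i"] by (simp add: buys_def U_S)
    with buys j show "V \<omega> 0 \<le> V \<omega> j - r j \<and> rivals j {..<card T - k} (V \<omega> j - r j) (V \<omega>)"
      by (auto simp: buys_def rivals_def U_0 U_S)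
  qed
  moreover have "(\<rho> - R) * \<P>(\<omega> in M. buys_opaque_as j \<omega>) \<le> exp (v j - R - 1) * prob ?B"
    using j by (intro rivals_bound) (auto simp: buys_opaque_as_def rivals_def U_0 U_S)
  moreover have "prob ?A + prob ?B \<le> \<P>(\<omega> in M. buys 0 \<omega>)"
  proof -
    have "prob ?A + prob ?B = prob (?A \<union> ?B)"
      by (rule finite_measure_Union[symmetric, OF ev ev]) (auto simp: rivals_def)
    also have "\<dots> \<le> \<P>(\<omega> in M. buys 0 \<omega>)"
    proof (rule finite_measure_mono)
      show "?A \<union> ?B \<subseteq> {\<omega> \<in> space M. buys 0 \<omega>}"
      proof
        fix \<omega> assume *: "\<omega> \<in> ?A \<union> ?B"
        have "U \<omega> i \<le> V \<omega> 0" if "i \<in> S" for i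
          using * that less j by (cases "i = j") (auto simp: rivals_def U_S)
        \<comment> \<open>In \<open>?A\<close> the strict count leaves room for \<open>j\<close>
          itself to reach the threshold; in \<open>?B\<close> product \<open>j\<close> stays below
          it.\<close>
        moreover have "beats_opaque (V \<omega> 0) \<omega>"
          using * split[of "\<lambda>i. V \<omega> 0 + \<rho> \<le> V \<omega> i"] by (auto simp: rivals_def)
        ultimately show "\<omega> \<in> {\<omega> \<in> space M. buys 0 \<omega>}"
          using * by (auto simp: buys_def U_0)
      qed
    qed (use events in auto)
    finally show ?thesis .
  qed
  ultimately have "(r j - R) * \<P>(\<omega> in M. buys j \<omega>) + (\<rho> - R) * \<P>(\<omega> in M. buys_opaque_as j \<omega>)
      \<le> exp (v j - R - 1) * (prob ?A + prob ?B)"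
    by (simp add: distrib_left)
  also have "\<dots> \<le> exp (v j - R - 1) * \<P>(\<omega> in M. buys 0 \<omega>)"
    using \<open>prob ?A + prob ?B \<le> _\<close> by (intro mult_left_mono) auto
  finally show ?thesis .
next
  \<comment> \<open>Here an opaque sale can be charged to \<open>j\<close> only if \<open>\<rho> = r j\<close>, so all charged sales have price \<open>r j\<close>.\<close>
  case False
  let ?A = "{\<omega> \<in> space M. V \<omega> j - r j < V \<omega> 0 \<and> rivals j {..card T - k} (V \<omega> 0) (V \<omega>)}"
  have card_le: "card {i \<in> T - {j}. P i} \<le> card {i \<in> T. P i}" for P
    using finite_T by (intro card_mono) auto
  have price: "\<rho> = r j" if "buys_opaque_as j \<omega>" for \<omega>
    using that False j by (force simp: buys_opaque_as_def U_S)
  have disj: "\<not> buys_opaque_as j \<omega>" if "buys j \<omega>" for \<omega>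
  proof
    assume as: "buys_opaque_as j \<omega>"
    have "beats_opaque (U \<omega> j) \<omega>"
      using that by (simp add: buys_def)
    moreover have "U \<omega> j + \<rho> = V \<omega> j"
      using j price[OF as] by (simp add: U_S)
    ultimately have "card {i \<in> T. V \<omega> j \<le> V \<omega> i} \<le> card T - k"
      by (simp only:)
    with as card_Collect_remove[OF finite_T, of j "\<lambda>i. V \<omega> j \<le> V \<omega> i"] show False
      by (simp add: buys_opaque_as_def)
  qed
  \<comment> \<open>Either the two prices agree or no opaque sale is charged to \<open>j\<close> at
    all.\<close>
  have shift: "(\<rho> - R) * \<P>(\<omega> in M. buys_opaque_as j \<omega>) = (r j - R) * \<P>(\<omega> in M. buys_opaque_as j \<omega>)"
  proof (cases "\<rho> = r j")
    case False
    then have "\<P>(\<omega> in M. buys_opaque_as j \<omega>) = 0"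
      using price by (metis (mono_tags, lifting) Collect_empty_eq measure_empty)
    then show ?thesis by simp
  qed simp
  have union: "\<P>(\<omega> in M. buys j \<omega>) + \<P>(\<omega> in M. buys_opaque_as j \<omega>) =
      \<P>(\<omega> in M. buys j \<omega> \<or> buys_opaque_as j \<omega>)"
    using disj events j by (subst finite_measure_Union[symmetric]) (auto intro!: arg_cong[where f = prob])
  have "(r j - R) * \<P>(\<omega> in M. buys j \<omega>) + (\<rho> - R) * \<P>(\<omega> in M. buys_opaque_as j \<omega>) =
      (r j - R) * \<P>(\<omega> in M. buys j \<omega> \<or> buys_opaque_as j \<omega>)"
    unfolding shift union[symmetric] by (rule distrib_left[symmetric])
  also have "\<dots> \<le> exp (v j - R - 1) * prob ?A"
  proof (rule rivals_bound[OF j])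
    fix \<omega> assume "buys j \<omega> \<or> buys_opaque_as j \<omega>"
    then show "V \<omega> 0 \<le> V \<omega> j - r j \<and> rivals j {..card T - k} (V \<omega> j - r j) (V \<omega>)"
    proof
      assume buys: "buys j \<omega>"
      then have "beats_opaque (V \<omega> j - r j) \<omega>"
        using j by (simp only: buys_def U_S)
      then have "card {i \<in> T - {j}. V \<omega> j - r j + \<rho> \<le> V \<omega> i} \<le> card T - k"
        by (rule order_trans[OF card_le])
      with buys j show ?thesis
        by (simp add: buys_def rivals_def U_0 U_S)
    next
      assume as: "buys_opaque_as j \<omega>"
      then have "V \<omega> 0 \<le> V \<omega> j - \<rho> \<and> rivals j {..card T - k} (V \<omega> j - \<rho>) (V \<omega>)"
        using j by (auto simp: buys_opaque_as_def rivals_def U_0 U_S)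
      then show ?thesis
        by (simp only: price[OF as])
    qed
  qed
  also have "\<dots> \<le> exp (v j - R - 1) * \<P>(\<omega> in M. buys 0 \<omega>)"
  proof (intro mult_left_mono finite_measure_mono)
    show "?A \<subseteq> {\<omega> \<in> space M. buys 0 \<omega>}"
    proof
      fix \<omega> assume *: "\<omega> \<in> ?A"
      have "U \<omega> i \<le> V \<omega> 0" if "i \<in> S" for i
        using * that j by (cases "i = j") (auto simp: rivals_def U_S)
      \<comment> \<open>If \<open>j\<close> lies in \<open>T\<close>, then
        \<open>r j \<le> \<rho>\<close> in this case, so
        \<open>V \<omega> j < V \<omega> 0 + r j\<close> keeps \<open>j\<close> below the
        threshold.\<close>
      moreover have "{i \<in> T. V \<omega> 0 + \<rho> \<le> V \<omega> i} = {i \<in> T - {j}. V \<omega> 0 + \<rho> \<le> V \<omega> i}"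
        using * False by auto
      then have "beats_opaque (V \<omega> 0) \<omega>"
        using * by (simp add: rivals_def)
      ultimately show "\<omega> \<in> {\<omega> \<in> space M. buys 0 \<omega>}"
        using * by (auto simp: buys_def U_0)
    qed
  qed (use events in auto)
  finally show ?thesis .
qed

lemma opq_revenue_le:
  assumes R: "(\<Sum>j\<in>S. exp (v j)) * exp (- R - 1) = R"
  shows "opq_revenue M eps v k T S r \<rho> \<le> R"
proof -
  let ?b = "\<lambda>j. \<P>(\<omega> in M. buys j \<omega>)" and ?o = "\<lambda>j. \<P>(\<omega> in M. buys_opaque_as j \<omega>)"
  have "opq_revenue M eps v k T S r \<rho> = (\<Sum>j\<in>S. r j * ?b j + \<rho> * ?o j)"
    by (simp add: opq_revenue_def opq_prob_product_eq opq_prob_opaque_eq prob_buys_opaque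
        sum.distrib sum_distrib_left)
  \<comment> \<open>Each sale is split into its surplus over \<open>R\<close> and the amount
    \<open>R\<close> itself; the latter part totals \<open>R\<close> times the probability of a
    purchase.\<close>
  also have "\<dots> = (\<Sum>j\<in>S. (r j - R) * ?b j + (\<rho> - R) * ?o j) + R * (\<Sum>j\<in>S. ?b j + ?o j)"
    by (simp add: sum_distrib_left algebra_simps flip: sum.distrib)
  also have "(\<Sum>j\<in>S. ?b j + ?o j) = 1 - ?b 0"
  proof -
    have "0 \<notin> S"
      using S by auto
    then show ?thesis
      using sum_prob_buys finite_S by (simp add: prob_buys_opaque sum.distrib)
  qed
  also have "(\<Sum>j\<in>S. (r j - R) * ?b j + (\<rho> - R) * ?o j) \<le> (\<Sum>j\<in>S. exp (v j - R - 1) * ?b 0)"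
    by (intro sum_mono product_bound)
  also have "(\<Sum>j\<in>S. exp (v j - R - 1) * ?b 0) = R * ?b 0"
  proof -
    have "(\<Sum>j\<in>S. exp (v j - R - 1)) = (\<Sum>j\<in>S. exp (v j)) * exp (- R - 1)"
      unfolding sum_distrib_right mult_exp_exp by (simp add: algebra_simps)
    with R show ?thesis
      by (simp flip: sum_distrib_right)
  qed
  finally show ?thesis
    by (simp add: algebra_simps)
qed

end

section \<open>The traditional model and the optimal uniform price\<close>

context gumbel_choice
begin

text \<open>The traditional model is the opaque model with empty opaque support.\<close>

lemma trad_market:
  assumes "S \<subseteq> {1..n}"
  shows "opaque_market M n eps (Suc 0) S {}"
  using assms by unfold_locales auto

text \<open>With empty support both counts in \<open>beats_opaque\<close> are 0, so that condition
  always holds and only the comparison within \<open>insert 0 S\<close> remains.\<close>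

lemma trad_prob_eq:
  assumes S: "S \<subseteq> {1..n}"
  shows "trad_prob M eps v S r i = \<P>(\<omega> in M. opaque_market.buys eps v (Suc 0) S {} r 0 i \<omega>)"
  by (simp add: trad_prob_def opaque_market.buys_def[OF trad_market[OF S]])

lemma sum_trad_prob:
  assumes S: "S \<subseteq> {1..n}"
  shows "(\<Sum>i\<in>insert 0 S. trad_prob M eps v S r i) = 1"
proof -
  interpret opaque_market M n eps v "Suc 0" S "{}" r 0
    by (rule trad_market[OF S])
  have "\<not> buys_opaque \<omega>" for \<omega>
    by (auto simp: buys_opaque_def)
  then show ?thesis
    using sum_prob_buys by (simp only: trad_prob_eq[OF S]) simp
qed

lemma trad_prob_product:
  assumes S: "S \<subseteq> {1..n}" and i: "i \<in> S"
  shows "trad_prob M eps v S r i = exp (v i - r i) * trad_prob M eps v S r 0"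
proof -
  interpret opaque_market M n eps v "Suc 0" S "{}" r 0
    by (rule trad_market[OF S])
  \<comment> \<open>The count over the empty support is 0, so the set \<open>{0}\<close> imposes no
    restriction.\<close>
  let ?lose = "\<lambda>\<omega>. V \<omega> i - r i < V \<omega> 0 \<and> rivals i {0} (V \<omega> 0) (V \<omega>)"
  have "Measurable.pred (borel \<Otimes>\<^sub>M PiM ({1..n} - {i}) (\<lambda>_. borel)) (\<lambda>x. rivals i {0} (fst x) (snd x))"
    using S by (intro measurable_rivals measurable_compose[OF measurable_snd] measurable_component_singleton) auto
  moreover have "i \<in> {1..n}"
    using i S by blast
  ultimately have "\<P>(\<omega> in M. V \<omega> 0 \<le> V \<omega> i - r i \<and> rivals i {0} (V \<omega> i - r i) (V \<omega>)) =
      exp (v i - r i) * \<P>(\<omega> in M. ?lose \<omega>)"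
    using exchange[of i "rivals i {0}" "r i", unfolded rivals_restrict] by blast
  moreover have "V \<omega> 0 \<le> V \<omega> i - r i \<and> rivals i {0} (V \<omega> i - r i) (V \<omega>) \<longleftrightarrow> buys i \<omega>" for \<omega>
    using i by (auto simp: buys_def rivals_def U_0 U_S)
  moreover have "\<P>(\<omega> in M. ?lose \<omega>) = \<P>(\<omega> in M. buys 0 \<omega>)"
  \<comment> \<open>The two events differ only in strict against weak comparison of \<open>i\<close>
    with 0, and ties are null.\<close>
  proof (rule finite_measure_eq_AE)
    show "AE \<omega> in M. \<omega> \<in> {\<omega> \<in> space M. ?lose \<omega>} \<longleftrightarrow> \<omega> \<in> {\<omega> \<in> space M. buys 0 \<omega>}"
      using AE_inj_U
    proof eventually_elim
      case (elim \<omega>)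
      have "i \<noteq> 0"
        using i S by auto
      then have "U \<omega> i \<noteq> U \<omega> 0"
        using elim i by (auto simp: inj_on_def)
      then have "?lose \<omega> \<longleftrightarrow> buys 0 \<omega>"
        using i by (auto simp: buys_def rivals_def U_0 U_S)
      then show ?case by simp
    qed
    have [measurable]: "(\<lambda>\<omega>. V \<omega> i) \<in> borel_measurable M" "(\<lambda>\<omega>. V \<omega> 0) \<in> borel_measurable M"
      "Measurable.pred M (\<lambda>\<omega>. rivals i {0} (V \<omega> 0) (V \<omega>))"
      using i by (auto intro!: measurable_rivals measurable_V')
    show "{\<omega> \<in> space M. ?lose \<omega>} \<in> events"
      by measurable
    show "{\<omega> \<in> space M. buys 0 \<omega>} \<in> events"
      using events(1)[of 0] by simp
  qed
  ultimately show ?thesis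
    by (simp add: trad_prob_eq[OF S])
qed

text \<open>The odds of each product against no purchase, together with total probability 1,
  determine the no-purchase probability and recover the MNL formula.\<close>

lemma trad_revenue_uniform:
  assumes S: "S \<subseteq> {1..n}"
  shows "trad_revenue M eps v S (\<lambda>_. p) =
    p * (\<Sum>i\<in>S. exp (v i - p)) / (1 + (\<Sum>i\<in>S. exp (v i - p)))"
proof -
  let ?w = "\<Sum>i\<in>S. exp (v i - p)" and ?t = "trad_prob M eps v S (\<lambda>_. p)"
  have S': "finite S" "0 \<notin> S"
    using S finite_subset by auto
  have sum: "(\<Sum>i\<in>S. ?t i) = ?w * ?t 0"
    unfolding sum_distrib_right by (intro sum.cong refl trad_prob_product[OF S])
  have "0 \<le> ?w"
    by (intro sum_nonneg) simp
  moreover have "?t 0 * (1 + ?w) = 1"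
    using sum_trad_prob[OF S, of "\<lambda>_. p"] S' sum by (simp add: algebra_simps)
  ultimately have "?t 0 = 1 / (1 + ?w)"
    by (simp add: eq_divide_eq)
  with sum show ?thesis
    by (simp add: trad_revenue_def flip: sum_distrib_left)
qed

text \<open>Every sale earns \<open>p\<close>, so only the no-purchase probability matters. At equal
  prices the opaque product is never better than the best product of \<open>T\<close>, hence almost
  surely it wins over no option 0 that all products lose to.\<close>

lemma opq_revenue_uniform:
  assumes S: "S \<subseteq> {1..n}" and T: "T \<subseteq> S" and k: "1 \<le> k"
  shows "opq_revenue M eps v k T S (\<lambda>_. p) p = trad_revenue M eps v S (\<lambda>_. p)"
proof -
  interpret opaque_market M n eps v k S T "\<lambda>_. p" p
    using S T k by unfold_locales
  let ?t = "trad_prob M eps v S (\<lambda>_. p)"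
  interpret trad: opaque_market M n eps v "Suc 0" S "{}" "\<lambda>_. p" 0
    by (rule trad_market[OF S])
  have S': "finite S" "0 \<notin> S"
    using S finite_subset by auto
  have "\<P>(\<omega> in M. buys 0 \<omega>) = \<P>(\<omega> in M. trad.buys 0 \<omega>)"
  proof (rule finite_measure_eq_AE)
    show "AE \<omega> in M. \<omega> \<in> {\<omega> \<in> space M. buys 0 \<omega>} \<longleftrightarrow> \<omega> \<in> {\<omega> \<in> space M. trad.buys 0 \<omega>}"
      using AE_inj_U
    proof eventually_elim
      case (elim \<omega>)
      have "beats_opaque (U \<omega> 0) \<omega>" if "trad.buys 0 \<omega>"
      proof -
        \<comment> \<open>Beating every product strictly empties the set counted in
          \<open>beats_opaque\<close>; strictness comes from the absence of ties.\<close>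
        have "V \<omega> i < U \<omega> 0 + p" if "i \<in> T" for i
        proof -
          have i: "i \<in> S" "i \<noteq> 0"
            using that T S by auto
          then have "U \<omega> i \<noteq> U \<omega> 0"
            using elim by (auto simp: inj_on_def)
          then show ?thesis
            using \<open>trad.buys 0 \<omega>\<close> i(1) by (auto simp: trad.buys_def U_S)
        qed
        then have none: "{i \<in> T. U \<omega> 0 + p \<le> V \<omega> i} = {}"
          by force
        show ?thesis
          unfolding none by simp
      qed
      then have "buys 0 \<omega> \<longleftrightarrow> trad.buys 0 \<omega>"
        by (auto simp: buys_def trad.buys_def)
      then show ?case by simp
    qed
  qed (use events(1)[of 0] trad.events(1)[of 0] in simp_all)
  then have "\<P>(\<omega> in M. buys 0 \<omega>) = ?t 0"
    by (simp only: trad_prob_eq[OF S])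
  then have "(\<Sum>j\<in>S. \<P>(\<omega> in M. buys j \<omega>)) + \<P>(\<omega> in M. buys_opaque \<omega>) = (\<Sum>j\<in>S. ?t j)"
    using sum_prob_buys sum_trad_prob[OF S, of "\<lambda>_. p"] S' by simp
  then have "p * ((\<Sum>j\<in>S. \<P>(\<omega> in M. buys j \<omega>)) + \<P>(\<omega> in M. buys_opaque \<omega>)) = p * (\<Sum>j\<in>S. ?t j)"
    by (rule arg_cong)
  then show ?thesis
    unfolding opq_revenue_def trad_revenue_def opq_prob_product_eq opq_prob_opaque_eq
      sum_distrib_left[symmetric] distrib_left[symmetric] .
qed

end

section \<open>The optimal revenue and the final comparison\<close>

lemma iid_gumbelD:
  assumes "iid_gumbel M {0..n} eps"
  shows "gumbel_choice M n eps"
proof -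
  interpret prob_space M
    using assms by (simp add: iid_gumbel_def)
  show ?thesis
  proof
    show "indep_vars (\<lambda>_. borel) eps {0..n}"
      using assms by (simp add: iid_gumbel_def)
    show "distr M borel (eps i) = gumbel" if "i \<le> n" for i
    proof -
      have "distributed M lborel (eps i) (\<lambda>x. ennreal (gumbel_density x))"
        using assms that by (simp add: iid_gumbel_def)
      then have "distr M lborel (eps i) = gumbel"
        by (simp add: distributed_distr_eq_density gumbel_def)
      moreover have "distr M lborel (eps i) = distr M borel (eps i)"
        by (rule distr_cong) auto
      ultimately show ?thesis by simp
    qed
  qed
qed

text \<open>With w the sum of \<open>exp (v i)\<close> and r = R + 1, this equation is the condition
  1 + sum of \<open>exp (v i - r)\<close> = r on the optimal uniform price. The intermediate value
  theorem solves it on the interval from 0 to \<open>w\<close>.\<close>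

lemma exists_fixed_revenue:
  fixes w :: real
  assumes "0 \<le> w"
  obtains R where "0 \<le> R" "w * exp (- R - 1) = R"
proof -
  let ?f = "\<lambda>x. x - w * exp (- x - 1)"
  have "w * exp (- w - 1) \<le> w * 1"
    using assms by (intro mult_left_mono) auto
  then have "\<exists>x. 0 \<le> x \<and> x \<le> w \<and> ?f x = 0"
    using assms by (intro IVT') (auto intro!: continuous_intros)
  then show thesis
    using that by auto
qed

theorem theorem1:
  fixes n k :: nat and M :: "'a measure" and eps :: "nat \<Rightarrow> 'a \<Rightarrow> real"
    and v :: "nat \<Rightarrow> real" and S T :: "nat set" and r_star :: real
  assumes "iid_gumbel M {0..n} eps"
    and "S \<subseteq> {1..n}" and "T \<subseteq> S" and "k \<in> {1..n}"
    and "r_star = opt_uniform_price M eps v S"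
  shows "0 \<le> r_star \<and>
    (\<forall>r \<rho>. (\<forall>i\<in>S. 0 \<le> r i) \<and> 0 \<le> \<rho> \<longrightarrow>
       opq_revenue M eps v k T S r \<rho> \<le> opq_revenue M eps v k T S (\<lambda>_. r_star) r_star) \<and>
    opq_revenue M eps v k T S (\<lambda>_. r_star) r_star = trad_revenue M eps v S (\<lambda>_. r_star)"
proof -
  interpret gumbel_choice M n eps v
    by (rule iid_gumbelD[OF assms(1)])
  note S = assms(2) and T = assms(3)
  have k: "1 \<le> k"
    using assms(4) by simp
  let ?w = "\<Sum>i\<in>S. exp (v i)" and ?trad = "\<lambda>p. trad_revenue M eps v S (\<lambda>_. p)"
  have "0 \<le> ?w"
    by (intro sum_nonneg) simp
  then obtain R where R: "0 \<le> R" "?w * exp (- R - 1) = R"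
    by (rule exists_fixed_revenue)
  have bound: "opq_revenue M eps v k T S r \<rho> \<le> R" for r \<rho>
  proof -
    interpret opaque_market M n eps v k S T r \<rho>
      using S T k by unfold_locales
    show ?thesis
      using R(2) by (rule opq_revenue_le)
  qed
  have uniform: "opq_revenue M eps v k T S (\<lambda>_. p) p = ?trad p" for p
    using S T k by (rule opq_revenue_uniform)
  have "(\<Sum>i\<in>S. exp (v i - (R + 1))) = ?w * exp (- R - 1)"
    unfolding sum_distrib_right mult_exp_exp by (simp add: algebra_simps)
  \<comment> \<open>At price R + 1 the exponential weights sum to \<open>R\<close>, so the revenue
    is (R + 1) * R / (1 + R).\<close>
  then have attained: "?trad (R + 1) = R"
    using R by (simp add: trad_revenue_uniform[OF S] field_simps)
  have le: "?trad p \<le> R" for p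
    using bound[of "\<lambda>_. p" p] by (simp only: uniform)
  have "0 \<le> r_star \<and> ?trad r_star = R"
    unfolding assms(5) opt_uniform_price_def
  \<comment> \<open>The price R + 1 witnesses that a maximizer exists. Whichever maximizer
    \<open>arg_max\<close> selects earns exactly \<open>R\<close>; this includes
    \<open>S = {}\<close>, where \<open>R\<close> is 0 and every nonnegative price is a
    maximizer.\<close>
  proof (rule arg_maxI[where x = "R + 1"])
    show "0 \<le> R + 1"
      using R(1) by simp
    show "\<not> ?trad p > ?trad (R + 1)" for p
      using le[of p] by (simp add: attained)
    fix p :: real
    assume p: "0 \<le> p" "\<forall>y. 0 \<le> y \<longrightarrow> \<not> ?trad y > ?trad p"
    then have "R \<le> ?trad p"
      using R(1) attained by (metis add_nonneg_nonneg not_le zero_le_one)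
    with p(1) le[of p] show "0 \<le> p \<and> ?trad p = R"
      by simp
  qed
  then show ?thesis
    using bound uniform by simp
qed

end
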